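(* Let $n\ge 1$ and let $S\in\{\mathcal{LS}_n,\mathcal{SS}_n\}$. Then $S$ is abundant.
   Context: Let $[n]=\{1,2,\ldots,n\}$ with its usual order. A partial transformation of $[n]$ is a map $\alpha$ whose domain $\mathrm{Dom}\,\alpha$ and image $\mathrm{Im}\,\alpha$ are subsets of $[n]$ (the empty map is allowed); maps are written on the right and composed left to right: $x(\alpha\beta)=(x\alpha)\beta$. $\alpha$ is isotone if $x\le y$ implies $x\alpha\le y\alpha$ for all $x,y\in\mathrm{Dom}\,\alpha$, and order-decreasing if $x\alpha\le x$ for all $x\in\mathrm{Dom}\,\alpha$. $\mathcal{LS}_n$ (the large Schröder monoid) is the semigroup of all isotone order-decreasing partial transformations of $[n]$, and $\mathcal{SS}_n=\{\alpha\in\mathcal{LS}_n : 1\in\mathrm{Dom}\,\alpha\}$ (the small Schröder monoid) is a subsemigroup of it. For a semigroup $S$, with $S^1$ denoting $S$ with an identity adjoined if necessary, $a\,\mathcal{L}^*\,b$ means: for all $x,y\in S^1$, $ax=ay\iff bx=by$; and $a\,\mathcal{R}^*\,b$ means: for all $x,y\in S^1$, $xa=ya\iff xb=yb$. $S$ is abundant if each $\mathcal{L}^*$-class and each $\mathcal{R}^*$-class of $S$ contains an idempotent. *)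

theory Defs
  imports Main
begin

text \<open>
  A semigroup is given by a carrier \<open>S\<close> and a multiplication \<open>m\<close>, which only matters on \<open>S\<close>.
\<close>

definition semigroup_on :: "'a set \<Rightarrow> ('a \<Rightarrow> 'a \<Rightarrow> 'a) \<Rightarrow> bool" where
  "semigroup_on S m \<longleftrightarrow>
     (\<forall>a\<in>S. \<forall>b\<in>S. m a b \<in> S) \<and>
     (\<forall>a\<in>S. \<forall>b\<in>S. \<forall>c\<in>S. m (m a b) c = m a (m b c))"

definition has_identity :: "'a set \<Rightarrow> ('a \<Rightarrow> 'a \<Rightarrow> 'a) \<Rightarrow> bool" where
  "has_identity S m \<longleftrightarrow> (\<exists>e\<in>S. \<forall>a\<in>S. m e a = a \<and> m a e = a)"

text \<open>
  The semigroup \<open>S\<^sup>1\<close> lives on the option type: \<open>Some a\<close> is the element \<open>a\<close> of \<open>S\<close>, and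
  \<open>None\<close> is the adjoined identity, present only if \<open>S\<close> has no identity of its own.
\<close>

definition S1_carrier :: "'a set \<Rightarrow> ('a \<Rightarrow> 'a \<Rightarrow> 'a) \<Rightarrow> 'a option set" where
  "S1_carrier S m = Some ` S \<union> (if has_identity S m then {} else {None})"

fun S1_mult :: "('a \<Rightarrow> 'a \<Rightarrow> 'a) \<Rightarrow> 'a option \<Rightarrow> 'a option \<Rightarrow> 'a option" where
  "S1_mult m None y = y"
| "S1_mult m (Some a) None = Some a"
| "S1_mult m (Some a) (Some b) = Some (m a b)"

definition Lstar :: "'a set \<Rightarrow> ('a \<Rightarrow> 'a \<Rightarrow> 'a) \<Rightarrow> ('a \<times> 'a) set" where
  "Lstar S m = {(a, b). a \<in> S \<and> b \<in> S \<and>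
     (\<forall>x\<in>S1_carrier S m. \<forall>y\<in>S1_carrier S m.
        S1_mult m (Some a) x = S1_mult m (Some a) y \<longleftrightarrow>
        S1_mult m (Some b) x = S1_mult m (Some b) y)}"

definition Rstar :: "'a set \<Rightarrow> ('a \<Rightarrow> 'a \<Rightarrow> 'a) \<Rightarrow> ('a \<times> 'a) set" where
  "Rstar S m = {(a, b). a \<in> S \<and> b \<in> S \<and>
     (\<forall>x\<in>S1_carrier S m. \<forall>y\<in>S1_carrier S m.
        S1_mult m x (Some a) = S1_mult m y (Some a) \<longleftrightarrow>
        S1_mult m x (Some b) = S1_mult m y (Some b))}"

lemma equiv_Lstar: "equiv S (Lstar S m)"
  unfolding Lstar_def by (rule equivI) (auto simp: refl_on_def sym_def trans_def)

lemma equiv_Rstar: "equiv S (Rstar S m)"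
  unfolding Rstar_def by (rule equivI) (auto simp: refl_on_def sym_def trans_def)

definition abundant :: "'a set \<Rightarrow> ('a \<Rightarrow> 'a \<Rightarrow> 'a) \<Rightarrow> bool" where
  "abundant S m \<longleftrightarrow> semigroup_on S m \<and>
     (\<forall>C\<in>S // Lstar S m. \<exists>e\<in>C. m e e = e) \<and>
     (\<forall>C\<in>S // Rstar S m. \<exists>e\<in>C. m e e = e)"

definition partial_transformations :: "nat \<Rightarrow> (nat \<rightharpoonup> nat) set" where
  "partial_transformations n = {\<alpha>. dom \<alpha> \<subseteq> {1..n} \<and> ran \<alpha> \<subseteq> {1..n}}"

text \<open>Maps act on the right, so in \<open>pcomp \<alpha> \<beta>\<close> the map \<open>\<alpha>\<close> is applied first.\<close>

definition pcomp :: "(nat \<rightharpoonup> nat) \<Rightarrow> (nat \<rightharpoonup> nat) \<Rightarrow> (nat \<rightharpoonup> nat)" where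
  "pcomp \<alpha> \<beta> = \<beta> \<circ>\<^sub>m \<alpha>"

definition isotone :: "(nat \<rightharpoonup> nat) \<Rightarrow> bool" where
  "isotone \<alpha> \<longleftrightarrow> mono_on (dom \<alpha>) (\<lambda>x. the (\<alpha> x))"

definition order_decreasing :: "(nat \<rightharpoonup> nat) \<Rightarrow> bool" where
  "order_decreasing \<alpha> \<longleftrightarrow> (\<forall>x\<in>dom \<alpha>. the (\<alpha> x) \<le> x)"

definition large_schroeder :: "nat \<Rightarrow> (nat \<rightharpoonup> nat) set" where
  "large_schroeder n = {\<alpha>\<in>partial_transformations n. isotone \<alpha> \<and> order_decreasing \<alpha>}"

definition small_schroeder :: "nat \<Rightarrow> (nat \<rightharpoonup> nat) set" where
  "small_schroeder n = {\<alpha>\<in>large_schroeder n. 1 \<in> dom \<alpha>}"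

end

theory Submission
  imports Defs
begin

text \<open>
  Both monoids contain the identity of \<open>[n]\<close>. The products \<open>\<alpha>\<xi>\<close> and \<open>\<alpha>\<eta>\<close> are equal if and
  only if \<open>\<xi>\<close> and \<open>\<eta>\<close> agree on the image of \<open>\<alpha>\<close>, so \<open>\<alpha>\<close> is \<open>\<L>\<^sup>*\<close>-related to the identity
  on its image. Dually, \<open>\<xi>\<alpha> = \<eta>\<alpha>\<close> depends only on the domain and the kernel of \<open>\<alpha>\<close>, so \<open>\<alpha>\<close>
  is \<open>\<R>\<^sup>*\<close>-related to the idempotent that sends each point of the domain to the least element
  of its kernel class. Choosing the least element makes this idempotent order-decreasing, and
  it is isotone because the kernel classes of an isotone map are convex in its domain.
  An order-decreasing map fixes 1 if it is defined there, so both idempotents stay in the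
  small monoid.
\<close>

text \<open>With an identity in \<open>S\<close> nothing is adjoined, so the quantifiers over
  \<open>S1_carrier\<close> range over \<open>S\<close> only. Every class is the class of some
  \<open>a\<close>, and the \<open>e\<close> provided for that \<open>a\<close> is an idempotent in
  it.\<close>

lemma abundantI:
  assumes "semigroup_on S m" "has_identity S m"
    and L: "\<And>a. a \<in> S \<Longrightarrow> \<exists>e\<in>S. m e e = e \<and> (\<forall>x\<in>S. \<forall>y\<in>S. m a x = m a y \<longleftrightarrow> m e x = m e y)"
    and R: "\<And>a. a \<in> S \<Longrightarrow> \<exists>e\<in>S. m e e = e \<and> (\<forall>x\<in>S. \<forall>y\<in>S. m x a = m y a \<longleftrightarrow> m x e = m y e)"
  shows "abundant S m"
proof -
  have carrier: "S1_carrier S m = Some ` S"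
    using assms(2) by (simp add: S1_carrier_def)
  have "\<exists>e\<in>C. m e e = e" if C: "C \<in> S // Lstar S m" for C
  proof -
    from C obtain a where a: "a \<in> S" "C = Lstar S m `` {a}"
      by (rule quotientE)
    with L[of a] show ?thesis
      by (force simp: Lstar_def carrier)
  qed
  moreover have "\<exists>e\<in>C. m e e = e" if C: "C \<in> S // Rstar S m" for C
  proof -
    from C obtain a where a: "a \<in> S" "C = Rstar S m `` {a}"
      by (rule quotientE)
    with R[of a] show ?thesis
      by (force simp: Rstar_def carrier)
  qed
  ultimately show ?thesis
    using assms(1) by (simp add: abundant_def)
qed

text \<open>A first-order form in terms of \<open>Some\<close> values, suited to chaining
  inequalities. The bounds 1 \<le> x and u \<le> n follow from 1 \<le> u \<le> x \<le> n.\<close>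

lemma large_schroeder_iff:
  "\<alpha> \<in> large_schroeder n \<longleftrightarrow>
    (\<forall>x u. \<alpha> x = Some u \<longrightarrow> 1 \<le> u \<and> u \<le> x \<and> x \<le> n) \<and>
    (\<forall>x y u v. \<alpha> x = Some u \<longrightarrow> \<alpha> y = Some v \<longrightarrow> x \<le> y \<longrightarrow> u \<le> v)"
  (is "_ \<longleftrightarrow> ?D \<and> ?I")
proof -
  have "isotone \<alpha> \<longleftrightarrow> ?I"
    by (force simp: isotone_def monotone_on_def dom_def)
  moreover have "\<alpha> \<in> partial_transformations n \<and> order_decreasing \<alpha> \<longleftrightarrow> ?D"
  proof
    assume ?D
    then show "\<alpha> \<in> partial_transformations n \<and> order_decreasing \<alpha>"
      unfolding partial_transformations_def order_decreasing_def ran_def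
      by (fastforce intro: order_trans)
  next
    assume \<alpha>: "\<alpha> \<in> partial_transformations n \<and> order_decreasing \<alpha>"
    show ?D
    proof (intro allI impI)
      fix x u assume x: "\<alpha> x = Some u"
      then have "x \<in> dom \<alpha>" "u \<in> ran \<alpha>" by (auto intro: ranI)
      with \<alpha> have "u \<in> {1..n}" "x \<in> {1..n}" "the (\<alpha> x) \<le> x"
        unfolding partial_transformations_def order_decreasing_def by blast+
      with x show "1 \<le> u \<and> u \<le> x \<and> x \<le> n" by simp
    qed
  qed
  ultimately show ?thesis
    by (auto simp: large_schroeder_def)
qed

lemma pcomp_eq_Some_iff:
  "pcomp \<alpha> \<beta> x = Some v \<longleftrightarrow> (\<exists>u. \<alpha> x = Some u \<and> \<beta> u = Some v)"
  by (simp add: pcomp_def map_comp_Some_iff)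

lemma pcomp_assoc: "pcomp (pcomp \<alpha> \<beta>) \<gamma> = pcomp \<alpha> (pcomp \<beta> \<gamma>)"
  by (simp add: pcomp_def map_comp_def fun_eq_iff split: option.split)

lemma pcomp_large_schroeder:
  assumes "\<alpha> \<in> large_schroeder n" "\<beta> \<in> large_schroeder n"
  shows "pcomp \<alpha> \<beta> \<in> large_schroeder n"
  unfolding large_schroeder_iff
proof (intro conjI allI impI)
  note D = assms[unfolded large_schroeder_iff]
  fix x v assume "pcomp \<alpha> \<beta> x = Some v"
  then obtain u where "\<alpha> x = Some u" "\<beta> u = Some v"
    by (auto simp: pcomp_eq_Some_iff)
  with D have "1 \<le> v" "v \<le> u" "u \<le> x" "x \<le> n" by blast+
  then show "1 \<le> v" "v \<le> x" "x \<le> n" by simp_all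
next
  fix x y v w
  assume "pcomp \<alpha> \<beta> x = Some v" "pcomp \<alpha> \<beta> y = Some w" "x \<le> y"
  then obtain s t where "\<alpha> x = Some s" "\<beta> s = Some v" "\<alpha> y = Some t" "\<beta> t = Some w"
    by (auto simp: pcomp_eq_Some_iff)
  with assms \<open>x \<le> y\<close> show "v \<le> w"
    unfolding large_schroeder_iff by blast
qed

lemma large_schroeder_fixes_1:
  assumes "\<alpha> \<in> large_schroeder n" "1 \<in> dom \<alpha>"
  shows "\<alpha> 1 = Some 1"
proof -
  from assms(2) obtain u where u: "\<alpha> 1 = Some u" by blast
  with assms(1) have "1 \<le> u" "u \<le> 1" unfolding large_schroeder_iff by blast+
  with u show ?thesis by simp
qed

lemma pcomp_small_schroeder:
  assumes "\<alpha> \<in> small_schroeder n" "\<beta> \<in> small_schroeder n"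
  shows "pcomp \<alpha> \<beta> \<in> small_schroeder n"
proof -
  \<comment> \<open>Fixing 1, unlike merely being defined there, passes at once to products.\<close>
  from assms have "\<alpha> \<in> large_schroeder n" "\<beta> \<in> large_schroeder n" "\<alpha> 1 = Some 1" "\<beta> 1 = Some 1"
    using large_schroeder_fixes_1 unfolding small_schroeder_def by blast+
  then have "pcomp \<alpha> \<beta> \<in> large_schroeder n" "pcomp \<alpha> \<beta> 1 = Some 1"
    by (simp_all only: pcomp_large_schroeder) (simp add: pcomp_def)
  then show ?thesis unfolding small_schroeder_def by blast
qed

definition partial_id :: "nat set \<Rightarrow> (nat \<rightharpoonup> nat)" where
  "partial_id A = Some |` A"

lemma partial_id_eq_Some_iff: "partial_id A x = Some u \<longleftrightarrow> x \<in> A \<and> u = x"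
  by (auto simp: partial_id_def restrict_map_def)

lemma dom_partial_id: "dom (partial_id A) = A"
  by (auto simp: partial_id_eq_Some_iff)

lemma partial_id_large_schroeder: "A \<subseteq> {1..n} \<Longrightarrow> partial_id A \<in> large_schroeder n"
  by (auto simp: large_schroeder_iff partial_id_eq_Some_iff)

lemma pcomp_partial_id_left: "pcomp (partial_id A) \<alpha> = \<alpha> |` A"
  by (auto simp: fun_eq_iff pcomp_def partial_id_def map_comp_def restrict_map_def)

lemma pcomp_partial_id_right:
  assumes "ran \<alpha> \<subseteq> A"
  shows "pcomp \<alpha> (partial_id A) = \<alpha>"
proof
  fix x
  show "pcomp \<alpha> (partial_id A) x = \<alpha> x"
    using assms by (cases "\<alpha> x") (auto simp: pcomp_def partial_id_def map_comp_def ran_def)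
qed

lemma map_restrict_subset: "dom \<alpha> \<subseteq> A \<Longrightarrow> \<alpha> |` A = \<alpha>"
  by (rule ext) (metis domIff restrict_in restrict_out subsetD)

text \<open>A left factor \<alpha> evaluates the other factor exactly at the points of
  \<open>ran \<alpha>\<close>. Stated with restrictions, the condition matches
  \<open>pcomp_partial_id_left\<close> for \<open>partial_id (ran \<alpha>)\<close>.\<close>

lemma pcomp_eq_iff_restrict_ran:
  "pcomp \<alpha> \<xi> = pcomp \<alpha> \<eta> \<longleftrightarrow> \<xi> |` ran \<alpha> = \<eta> |` ran \<alpha>"
proof -
  have "pcomp \<alpha> \<xi> = pcomp \<alpha> \<eta> \<longleftrightarrow> (\<forall>x u. \<alpha> x = Some u \<longrightarrow> \<xi> u = \<eta> u)"
    by (auto simp: pcomp_def map_comp_def fun_eq_iff split: option.split)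
  also have "\<dots> \<longleftrightarrow> \<xi> |` ran \<alpha> = \<eta> |` ran \<alpha>"
    by (auto simp: fun_eq_iff restrict_map_def ran_def)
  finally show ?thesis .
qed

text \<open>\<open>map_option\<close> keeps undefined points undefined; elsewhere
  \<open>LEAST\<close> ranges over the fibre through x, which is nonempty, so the minimum is
  attained.\<close>

definition kernel_min :: "(nat \<rightharpoonup> nat) \<Rightarrow> (nat \<rightharpoonup> nat)" where
  "kernel_min \<alpha> = (\<lambda>x. map_option (\<lambda>u. LEAST z. \<alpha> z = Some u) (\<alpha> x))"

lemma dom_kernel_min: "dom (kernel_min \<alpha>) = dom \<alpha>"
  by (auto simp: kernel_min_def dom_def)

lemma kernel_min_SomeE:
  assumes "kernel_min \<alpha> x = Some z"
  obtains u where "\<alpha> x = Some u" "\<alpha> z = Some u" "\<And>y. \<alpha> y = Some u \<Longrightarrow> z \<le> y"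
proof -
  from assms obtain u where u: "\<alpha> x = Some u" and z: "z = (LEAST z. \<alpha> z = Some u)"
    by (auto simp: kernel_min_def)
  from u have "\<alpha> z = Some u"
    unfolding z by (rule LeastI)
  with u that show thesis
    by (simp add: z Least_le)
qed

text \<open>The least element of a fibre lies in that fibre and so determines it. As an equation of
  options, this records equal domains along with equal kernels.\<close>

lemma kernel_min_eq_iff: "kernel_min \<alpha> x = kernel_min \<alpha> y \<longleftrightarrow> \<alpha> x = \<alpha> y"
proof
  assume eq: "kernel_min \<alpha> x = kernel_min \<alpha> y"
  show "\<alpha> x = \<alpha> y"
  proof (cases "kernel_min \<alpha> x")
    case None
    with eq show ?thesis by (simp add: kernel_min_def)
  next
    case (Some z)
    with eq show ?thesis by (metis kernel_min_SomeE)
  qed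
qed (simp add: kernel_min_def)

lemma kernel_min_idem: "pcomp (kernel_min \<alpha>) (kernel_min \<alpha>) = kernel_min \<alpha>"
proof
  fix x
  show "pcomp (kernel_min \<alpha>) (kernel_min \<alpha>) x = kernel_min \<alpha> x"
  proof (cases "kernel_min \<alpha> x")
    case (Some z)
    then have "\<alpha> z = \<alpha> x" by (metis kernel_min_SomeE)
    then have "kernel_min \<alpha> z = kernel_min \<alpha> x" by (simp add: kernel_min_eq_iff)
    with Some show ?thesis by (simp add: pcomp_def)
  qed (simp add: pcomp_def)
qed

lemma kernel_min_large_schroeder:
  assumes "\<alpha> \<in> large_schroeder n"
  shows "kernel_min \<alpha> \<in> large_schroeder n"
  unfolding large_schroeder_iff
proof (intro conjI allI impI)
  fix x z assume "kernel_min \<alpha> x = Some z"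
  then obtain u where u: "\<alpha> x = Some u" "\<alpha> z = Some u" "z \<le> x"
    by (metis kernel_min_SomeE)
  \<comment> \<open>The lower bound on z comes from \<alpha>, which sends z to u: 1 \<le> u \<le>
    z.\<close>
  with assms have "1 \<le> u" "u \<le> z" "x \<le> n"
    unfolding large_schroeder_iff by blast+
  with u show "1 \<le> z" "z \<le> x" "x \<le> n" by simp_all
next
  fix x y z w
  assume "kernel_min \<alpha> x = Some z" "kernel_min \<alpha> y = Some w" and "x \<le> y"
  then obtain u v where
    u: "\<alpha> x = Some u" "\<alpha> z = Some u" "\<And>t. \<alpha> t = Some u \<Longrightarrow> z \<le> t" and
    v: "\<alpha> y = Some v" "\<alpha> w = Some v"
    by (metis kernel_min_SomeE)
  have mono: "\<And>s t p q. \<lbrakk>\<alpha> s = Some p; \<alpha> t = Some q; s \<le> t\<rbrakk> \<Longrightarrow> p \<le> q"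
    using assms unfolding large_schroeder_iff by blast
  show "z \<le> w"
  proof (rule ccontr)
    assume "\<not> z \<le> w"
    \<comment> \<open>Monotonicity gives v \<le> u from w < z, and u \<le> v from x \<le> y. So w
      lies in the fibre whose minimum is z, although w < z.\<close>
    with mono[OF v(2) u(2)] mono[OF u(1) v(1)] \<open>x \<le> y\<close> have "u = v" by simp
    with u(3) v(2) \<open>\<not> z \<le> w\<close> show False by simp
  qed
qed

lemma pcomp_eq_iff_kernel_min:
  "pcomp \<xi> \<alpha> = pcomp \<eta> \<alpha> \<longleftrightarrow> pcomp \<xi> (kernel_min \<alpha>) = pcomp \<eta> (kernel_min \<alpha>)"
proof -
  \<comment> \<open>This settles the points where just one of \<xi> and \<eta> is defined: equality
    there means that the last factor is undefined at the one point reached.\<close>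
  have none: "kernel_min \<alpha> x = None \<longleftrightarrow> \<alpha> x = None" for x
    by (simp add: kernel_min_def)
  have "pcomp \<xi> \<alpha> x = pcomp \<eta> \<alpha> x \<longleftrightarrow>
    pcomp \<xi> (kernel_min \<alpha>) x = pcomp \<eta> (kernel_min \<alpha>) x" for x
    using none by (auto simp: pcomp_def map_comp_def kernel_min_eq_iff eq_commute[of None]
      split: option.split)
  then show ?thesis by (simp add: fun_eq_iff)
qed

theorem theorem2p11:
  fixes n :: nat and S :: "(nat \<rightharpoonup> nat) set"
  assumes "n \<ge> 1"
    and "S \<in> {large_schroeder n, small_schroeder n}"
  shows "abundant S pcomp"
proof (rule abundantI)
  have large: "\<alpha> \<in> large_schroeder n" if "\<alpha> \<in> S" for \<alpha>
    using that assms(2) by (auto simp: small_schroeder_def)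
  have ranges: "dom \<alpha> \<subseteq> {1..n}" "ran \<alpha> \<subseteq> {1..n}" if "\<alpha> \<in> S" for \<alpha>
    using large[OF that] by (auto simp: large_schroeder_def partial_transformations_def)
  \<comment> \<open>One criterion for both choices of \<open>S\<close>: in the small monoid \<alpha>
    is defined at 1, so the last premise puts 1 into \<open>dom \<beta>\<close>.\<close>
  have mem: "\<beta> \<in> S" if "\<alpha> \<in> S" "\<beta> \<in> large_schroeder n" "1 \<in> dom \<alpha> \<Longrightarrow> 1 \<in> dom \<beta>" for \<alpha> \<beta>
    using that assms(2) by (auto simp: small_schroeder_def)
  show "semigroup_on S pcomp"
    using assms(2) pcomp_large_schroeder pcomp_small_schroeder
    by (auto simp: semigroup_on_def pcomp_assoc)
  \<comment> \<open>From n \<ge> 1 the identity is defined at 1, as the small monoid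
    demands.\<close>
  have "partial_id {1..n} \<in> S"
    using assms partial_id_large_schroeder[of "{1..n}" n]
    by (auto simp: small_schroeder_def partial_id_eq_Some_iff)
  moreover have "pcomp (partial_id {1..n}) \<alpha> = \<alpha>" if "\<alpha> \<in> S" for \<alpha>
    using map_restrict_subset[OF ranges(1)[OF that]] by (simp only: pcomp_partial_id_left)
  moreover have "pcomp \<alpha> (partial_id {1..n}) = \<alpha>" if "\<alpha> \<in> S" for \<alpha>
    using ranges(2)[OF that] by (rule pcomp_partial_id_right)
  ultimately show "has_identity S pcomp"
    unfolding has_identity_def by blast
  fix \<alpha> assume \<alpha>: "\<alpha> \<in> S"
  show "\<exists>\<epsilon>\<in>S. pcomp \<epsilon> \<epsilon> = \<epsilon> \<and>
    (\<forall>\<xi>\<in>S. \<forall>\<eta>\<in>S. pcomp \<alpha> \<xi> = pcomp \<alpha> \<eta> \<longleftrightarrow> pcomp \<epsilon> \<xi> = pcomp \<epsilon> \<eta>)"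
  proof (intro bexI conjI ballI)
    \<comment> \<open>The domain of the chosen idempotent is the image of \<alpha>, so membership in
      the small monoid asks for 1 in that image.\<close>
    have "1 \<in> ran \<alpha>" if "1 \<in> dom \<alpha>"
      using large_schroeder_fixes_1[OF large[OF \<alpha>] that] by (rule ranI)
    then show "partial_id (ran \<alpha>) \<in> S"
      using mem[OF \<alpha> partial_id_large_schroeder[OF ranges(2)[OF \<alpha>]]]
      by (simp only: dom_partial_id)
    show "pcomp (partial_id (ran \<alpha>)) (partial_id (ran \<alpha>)) = partial_id (ran \<alpha>)"
      by (simp add: pcomp_partial_id_left) (simp add: partial_id_def)
  qed (simp add: pcomp_eq_iff_restrict_ran pcomp_partial_id_left)
  show "\<exists>\<epsilon>\<in>S. pcomp \<epsilon> \<epsilon> = \<epsilon> \<and>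
    (\<forall>\<xi>\<in>S. \<forall>\<eta>\<in>S. pcomp \<xi> \<alpha> = pcomp \<eta> \<alpha> \<longleftrightarrow> pcomp \<xi> \<epsilon> = pcomp \<eta> \<epsilon>)"
  proof (intro bexI conjI ballI)
    show "kernel_min \<alpha> \<in> S"
      using mem[OF \<alpha> kernel_min_large_schroeder[OF large[OF \<alpha>]]] by (simp add: dom_kernel_min)
  qed (rule kernel_min_idem pcomp_eq_iff_kernel_min)+
qed

end
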